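(* Let $\mathcal X=\prod_{i\in[n]}\mathcal X_i$ be finite, let $f:\mathcal X\to\mathcal Y=\{0,1\}$, and for $p\in(0,1)$ let the binary symmetric (randomized response) privacy channel of $f$ be $$p(y|x)=(1-p)^{1-|y-f(x)|}\,p^{|y-f(x)|},\qquad x\in\mathcal X,\ y\in\mathcal Y.$$ Let $\epsilon\in(0,1)$ and let $p^*\in(0,1/2)$ be the solution of $H(p)=\log 2-\epsilon$, where $H(p)=-p\log p-(1-p)\log(1-p)$. If $p\in(p^*,1-p^* )$, then the binary symmetric privacy channel satisfies $\epsilon$-information privacy with respect to $\mathbb P$.
   Context: $n\ge1$, $[n]=\{1,\dots,n\}$; $\mathcal X_1,\dots,\mathcal X_n$ are finite nonempty sets. All logarithms (in $H$, in $\log 2$, and in mutual information) are to base 2, so $\log 2=1$. $\mathbb P$ is the set of all probability distributions on $\mathcal X$. For $X=(X_1,\dots,X_n)$ with distribution in $\mathbb P$, $Y$ denotes the output of the channel $p(y|x)$ on input $X$. The individual channel capacity with respect to $\mathbb P$ is $C_1=\max_{i\in[n],X\in\mathbb P}I(X_i;Y)$, where $I$ is mutual information. The channel satisfies $\epsilon$-information privacy with respect to $\mathbb P$ if $C_1\le\epsilon$. *)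

theory Defs
  imports "HOL-Probability.Probability"
begin

text \<open>
  An input \<open>x = (x\<^sub>1, \<dots>, x\<^sub>n)\<close> is an element of \<open>PiE {1..n} Xs\<close>. A channel \<open>p(y|x)\<close> with
  input set \<open>A\<close> and output set \<open>B\<close> is its family of transition probabilities \<open>W x y\<close>.
\<close>

definition is_channel :: "'x set \<Rightarrow> 'y set \<Rightarrow> ('x \<Rightarrow> 'y \<Rightarrow> real) \<Rightarrow> bool" where
  "is_channel A B W \<longleftrightarrow> (\<forall>x\<in>A. (\<forall>y\<in>B. 0 \<le> W x y) \<and> (\<Sum>y\<in>B. W x y) = 1)"

definition distributions_on :: "'x set \<Rightarrow> 'x pmf set" where
  "distributions_on A = {P. set_pmf P \<subseteq> A}"

text \<open>The joint law of \<open>(X, Y)\<close> on \<open>A \<times> B\<close>, for \<open>X\<close> distributed as \<open>P\<close>.\<close>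

definition joint_law ::
    "'x set \<Rightarrow> 'y set \<Rightarrow> ('x \<Rightarrow> 'y \<Rightarrow> real) \<Rightarrow> 'x pmf \<Rightarrow> ('x \<times> 'y) measure" where
  "joint_law A B W P = point_measure (A \<times> B) (\<lambda>(x, y). ennreal (pmf P x * W x y))"

text \<open>The mutual information \<open>I(X\<^sub>i; Y)\<close>, in bits.\<close>

definition input_output_information ::
    "nat \<Rightarrow> (nat \<Rightarrow> 'a set) \<Rightarrow> 'y set \<Rightarrow> ((nat \<Rightarrow> 'a) \<Rightarrow> 'y \<Rightarrow> real) \<Rightarrow> nat
      \<Rightarrow> (nat \<Rightarrow> 'a) pmf \<Rightarrow> real" where
  "input_output_information n Xs B W i P =
     prob_space.mutual_information (joint_law (PiE {1..n} Xs) B W P) 2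
       (count_space (Xs i)) (count_space B) (\<lambda>(x, y). x i) (\<lambda>(x, y). y)"

text \<open>
  \<open>C\<^sub>1\<close>, with the maximum written as a supremum of reals. For a channel on finite sets the family
  is bounded above by \<open>bdd_above_input_output_information\<close> below.
\<close>

definition individual_capacity ::
    "nat \<Rightarrow> (nat \<Rightarrow> 'a set) \<Rightarrow> 'y set \<Rightarrow> (nat \<Rightarrow> 'a) pmf set
      \<Rightarrow> ((nat \<Rightarrow> 'a) \<Rightarrow> 'y \<Rightarrow> real) \<Rightarrow> real" where
  "individual_capacity n Xs B PP W =
     (SUP (i, P) \<in> {1..n} \<times> PP. input_output_information n Xs B W i P)"

definition information_privacy ::
    "nat \<Rightarrow> (nat \<Rightarrow> 'a set) \<Rightarrow> 'y set \<Rightarrow> (nat \<Rightarrow> 'a) pmf set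
      \<Rightarrow> ((nat \<Rightarrow> 'a) \<Rightarrow> 'y \<Rightarrow> real) \<Rightarrow> real \<Rightarrow> bool" where
  "information_privacy n Xs B PP W \<epsilon> \<longleftrightarrow> individual_capacity n Xs B PP W \<le> \<epsilon>"

definition binary_entropy :: "real \<Rightarrow> real" where
  "binary_entropy p = - p * log 2 p - (1 - p) * log 2 (1 - p)"

definition binary_symmetric_channel :: "real \<Rightarrow> ('x \<Rightarrow> int) \<Rightarrow> 'x \<Rightarrow> int \<Rightarrow> real" where
  "binary_symmetric_channel p f x y = (1 - p) powi (1 - \<bar>y - f x\<bar>) * p powi \<bar>y - f x\<bar>"

lemma is_channel_binary_symmetric_channel:
  assumes "0 < p" "p < 1" "f \<in> A \<rightarrow> {0, 1}"
  shows "is_channel A {0, 1} (binary_symmetric_channel p f)"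
  unfolding is_channel_def binary_symmetric_channel_def
proof
  fix x assume "x \<in> A"
  then have "f x = 0 \<or> f x = 1" using assms(3) by auto
  then show "(\<forall>y\<in>{0, 1}. 0 \<le> (1 - p) powi (1 - \<bar>y - f x\<bar>) * p powi \<bar>y - f x\<bar>) \<and>
      (\<Sum>y\<in>{0, 1}. (1 - p) powi (1 - \<bar>y - f x\<bar>) * p powi \<bar>y - f x\<bar>) = 1"
    using assms by auto
qed

lemma prob_space_joint_law:
  assumes "finite A" "finite B" "is_channel A B W" "P \<in> distributions_on A"
  shows "prob_space (joint_law A B W P)"
  unfolding joint_law_def
proof (rule prob_space_point_measure)
  have "(\<Sum>z\<in>A \<times> B. case z of (x, y) \<Rightarrow> ennreal (pmf P x * W x y))
      = (\<Sum>z\<in>A \<times> B. ennreal (case z of (x, y) \<Rightarrow> pmf P x * W x y))"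
    by (intro sum.cong) auto
  also have "\<dots> = ennreal (\<Sum>(x, y)\<in>A \<times> B. pmf P x * W x y)"
    using assms(3) by (intro sum_ennreal) (auto simp: is_channel_def)
  also have "(\<Sum>(x, y)\<in>A \<times> B. pmf P x * W x y) = (\<Sum>x\<in>A. pmf P x * (\<Sum>y\<in>B. W x y))"
    by (simp add: sum.cartesian_product[symmetric] sum_distrib_left)
  also have "\<dots> = (\<Sum>x\<in>A. pmf P x)"
    using assms(3) by (intro sum.cong) (auto simp: is_channel_def)
  also have "\<dots> = 1"
    using assms(1,4) by (intro sum_pmf_eq_1) (auto simp: distributions_on_def)
  finally show "(\<Sum>z\<in>A \<times> B. case z of (x, y) \<Rightarrow> ennreal (pmf P x * W x y)) = 1" by simp
qed (use assms in auto)

lemma (in information_space) mutual_information_simple_bound: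
  assumes "simple_function M X" "simple_function M Y"
  shows "\<I>(X ; Y) \<le> real (card (X ` space M) * card (Y ` space M)) / ln b"
proof -
  define Px where "Px x = prob (X -` {x} \<inter> space M)" for x
  define Py where "Py y = prob (Y -` {y} \<inter> space M)" for y
  define Pxy where "Pxy z = prob ((\<lambda>w. (X w, Y w)) -` {z} \<inter> space M)" for z
  let ?S = "(\<lambda>w. (X w, Y w)) ` space M"
  have sX: "simple_distributed M X Px"
    by (rule simple_distributedI) (auto simp: assms Px_def)
  have sY: "simple_distributed M Y Py"
    by (rule simple_distributedI) (auto simp: assms Py_def)
  have XY: "simple_function M (\<lambda>w. (X w, Y w))"
    using assms by (rule simple_function_Pair)
  have sXY: "simple_distributed M (\<lambda>w. (X w, Y w)) Pxy"
    by (rule simple_distributedI) (auto simp: XY Pxy_def)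
  have lnb: "0 < ln b" using b_gt_1 by simp
  have term_le: "Pxy (x, y) * log b (Pxy (x, y) / (Px x * Py y)) \<le> 1 / ln b" for x y
  proof (cases "Pxy (x, y) = 0")
    case True
    then show ?thesis using lnb by simp
  next
    case False
    then have pos: "0 < Pxy (x, y)"
      unfolding Pxy_def using measure_nonneg[of M] by (simp add: order_less_le)
    have le: "Pxy (x, y) \<le> Px x" "Pxy (x, y) \<le> Py y"
      unfolding Pxy_def Px_def Py_def
      by (rule finite_measure_mono;
          use assms simple_functionD(2) in auto)+
    have px: "0 < Px x" and py: "0 < Py y" using pos le by linarith+
    have "Pxy (x, y) / (Px x * Py y) \<le> 1 / Py y"
      using le pos px py by (simp add: divide_simps)
    then have "ln (Pxy (x, y) / (Px x * Py y)) \<le> ln (1 / Py y)"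
      using pos px py by (subst ln_le_cancel_iff) auto
    also have "\<dots> \<le> 1 / Py y - 1"
      using py by (intro ln_le_minus_one) auto
    finally have "ln (Pxy (x, y) / (Px x * Py y)) \<le> 1 / Py y" by simp
    then have "Pxy (x, y) * ln (Pxy (x, y) / (Px x * Py y)) \<le> Pxy (x, y) * (1 / Py y)"
      using pos by (intro mult_left_mono) auto
    also have "\<dots> \<le> 1" using le py by simp
    finally show ?thesis
      using lnb by (simp add: log_def divide_right_mono)
  qed
  have fin: "finite (X ` space M)" "finite (Y ` space M)"
    using assms by (auto dest: simple_functionD)
  have "\<I>(X ; Y) = (\<Sum>(x, y)\<in>?S. Pxy (x, y) * log b (Pxy (x, y) / (Px x * Py y)))"
    by (rule mutual_information_simple_distributed[OF sX sY sXY])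
  also have "\<dots> \<le> (\<Sum>z\<in>?S. 1 / ln b)"
    by (intro sum_mono) (auto intro: term_le)
  also have "\<dots> = real (card ?S) / ln b" by simp
  also have "\<dots> \<le> real (card (X ` space M) * card (Y ` space M)) / ln b"
  proof -
    have "card ?S \<le> card (X ` space M \<times> Y ` space M)"
      using fin by (intro card_mono) auto
    then have "card ?S \<le> card (X ` space M) * card (Y ` space M)"
      by (simp add: card_cartesian_product)
    then show ?thesis using lnb by (intro divide_right_mono of_nat_mono) auto
  qed
  finally show ?thesis .
qed

lemma bdd_above_input_output_information:
  fixes Xs :: "nat \<Rightarrow> 'a set"
  assumes "\<And>i. i \<in> {1..n} \<Longrightarrow> finite (Xs i) \<and> Xs i \<noteq> {}" and "finite B"
    and "is_channel (PiE {1..n} Xs) B W"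
  shows "bdd_above ((\<lambda>(i, P). input_output_information n Xs B W i P)
           ` ({1..n} \<times> distributions_on (PiE {1..n} Xs)))"
proof -
  let ?A = "PiE {1..n} Xs"
  have finA: "finite ?A" using assms(1) by (intro finite_PiE) auto
  have neA: "?A \<noteq> {}" using assms(1) by (auto simp: PiE_eq_empty_iff)
  have neB: "B \<noteq> {}" using assms(3) neA by (auto simp: is_channel_def)
  have bound: "input_output_information n Xs B W i P
      \<le> (\<Sum>j\<in>{1..n}. real (card (Xs j) * card B) / ln 2)"
    if i: "i \<in> {1..n}" and P: "P \<in> distributions_on ?A" for i P
  proof -
    let ?M = "joint_law ?A B W P"
    interpret prob_space ?M
      using finA assms(2,3) P by (rule prob_space_joint_law)
    interpret information_space ?M 2 by unfold_locales simp
    have sp: "space ?M = ?A \<times> B" by (simp add: joint_law_def space_point_measure)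
    have eqA: "(\<lambda>x. x i) ` ?A = Xs i" using i neA by (simp add: image_projection_PiE)
    have X: "(\<lambda>(x, y). x i) ` space ?M = Xs i"
      using neB unfolding sp eqA[symmetric] by force
    have Y: "(\<lambda>(x, y). y) ` space ?M = B"
      using neA unfolding sp by force
    have sf: "simple_function ?M (\<lambda>(x, y). x i)" "simple_function ?M (\<lambda>(x, y). y)"
      unfolding joint_law_def using finA assms(2) by auto
    have "input_output_information n Xs B W i P \<le> real (card (Xs i) * card B) / ln 2"
      using mutual_information_simple_bound[OF sf]
      unfolding X Y input_output_information_def .
    also have "\<dots> \<le> (\<Sum>j\<in>{1..n}. real (card (Xs j) * card B) / ln 2)"
      using i by (intro member_le_sum) auto
    finally show ?thesis .
  qed
  then show ?thesis
    by (intro bdd_aboveI[where M = "\<Sum>j\<in>{1..n}. real (card (Xs j) * card B) / ln 2"]) auto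
qed

end

theory Submission
  imports Defs
begin

text \<open>
  Conditioning on \<open>X\<^sub>i = a\<close> averages the transition probabilities of the channel, which all lie in
  \<open>[p\<^sup>*, 1 - p\<^sup>*]\<close>; hence so does \<open>P (Y = 0 | X\<^sub>i = a)\<close>, and its binary entropy is at least
  \<open>H(p\<^sup>*) = 1 - \<epsilon>\<close>. Therefore \<open>I(X\<^sub>i; Y) = H(Y) - H(Y | X\<^sub>i) \<le> 1 - (1 - \<epsilon>) = \<epsilon>\<close>.
\<close>

section \<open>Bounds for the binary entropy function\<close>

lemma gibbs_inequality_two_points:
  fixes p q :: real
  assumes "0 < p" "p < 1" "0 < q" "q < 1"
  shows "p * ln q + (1 - p) * ln (1 - q) \<le> p * ln p + (1 - p) * ln (1 - p)"
proof -
  \<comment> \<open>Relative entropy is nonnegative: weighted by \<open>p\<close> and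
    \<open>1 - p\<close>, these tangent-line bounds have right-hand sides \<open>q - p\<close> and
    \<open>p - q\<close>, which cancel.\<close>
  have "ln (q / p) \<le> q / p - 1" "ln ((1 - q) / (1 - p)) \<le> (1 - q) / (1 - p) - 1"
    using assms by (intro ln_le_minus_one divide_pos_pos; simp)+
  then have "p * ln (q / p) \<le> p * (q / p - 1)"
    "(1 - p) * ln ((1 - q) / (1 - p)) \<le> (1 - p) * ((1 - q) / (1 - p) - 1)"
    using assms by (intro mult_left_mono; simp)+
  moreover have "p * (q / p - 1) = q - p" "(1 - p) * ((1 - q) / (1 - p) - 1) = p - q"
    using assms by (simp_all add: right_diff_distrib[of _ "_ / _"])
  ultimately have "p * ln (q / p) + (1 - p) * ln ((1 - q) / (1 - p)) \<le> 0"
    by linarith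
  then show ?thesis
    using assms by (simp add: ln_div right_diff_distrib)
qed

lemma binary_entropy_eq_ln:
  "binary_entropy p = - (p * ln p + (1 - p) * ln (1 - p)) / ln 2"
  by (simp add: binary_entropy_def log_def diff_divide_distrib add_divide_distrib)

lemma binary_entropy_symmetric: "binary_entropy (1 - p) = binary_entropy p"
  by (simp add: binary_entropy_def algebra_simps)

lemma binary_entropy_half: "binary_entropy (1 / 2) = 1"
  by (simp add: binary_entropy_eq_ln ln_div)

lemma binary_entropy_mono:
  assumes "0 < d" "d \<le> q" "q \<le> 1 / 2"
  shows "binary_entropy d \<le> binary_entropy q"
proof -
  have "0 \<le> (q - d) * (ln (1 - q) - ln q)"
    using assms by (intro mult_nonneg_nonneg) auto
  then have "q * ln q + (1 - q) * ln (1 - q) \<le> d * ln q + (1 - d) * ln (1 - q)"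
    by (simp add: algebra_simps)
  also have "\<dots> \<le> d * ln d + (1 - d) * ln (1 - d)"
    using assms by (intro gibbs_inequality_two_points) auto
  finally show ?thesis
    by (simp add: binary_entropy_eq_ln divide_right_mono)
qed

lemma binary_entropy_ge:
  assumes "0 < d" "d \<le> q" "q \<le> 1 - d"
  shows "binary_entropy d \<le> binary_entropy q"
proof (cases "q \<le> 1 / 2")
  case True
  then show ?thesis using assms by (intro binary_entropy_mono)
next
  case False
  then have "binary_entropy d \<le> binary_entropy (1 - q)"
    using assms by (intro binary_entropy_mono) auto
  then show ?thesis by (simp add: binary_entropy_symmetric)
qed

lemma binary_entropy_le_1:
  assumes "0 < q" "q < 1"
  shows "binary_entropy q \<le> 1"
proof (cases "q \<le> 1 / 2")
  case True
  then show ?thesis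
    using assms binary_entropy_mono[of q "1 / 2"] by (simp add: binary_entropy_half)
next
  case False
  then show ?thesis
    using assms binary_entropy_mono[of "1 - q" "1 / 2"]
    by (simp add: binary_entropy_half binary_entropy_symmetric)
qed

section \<open>Mutual information with a binary output\<close>

text \<open>The contribution of one value \<open>a\<close> of \<open>X\<close> to \<open>I(X; Y)\<close>: here \<open>r\<close>, \<open>u\<close>, \<open>v\<close> stand for
  \<open>P (X = a)\<close>, \<open>P (X = a, Y = 0)\<close>, \<open>P (X = a, Y = 1)\<close>, and \<open>s\<close>, \<open>t\<close> for the law of \<open>Y\<close>.\<close>

lemma information_summand_le:
  fixes r u v s t d :: real
  assumes "0 \<le> r" "u + v = r" "d * r \<le> u" "d * r \<le> v" "0 < d" "0 < s" "0 < t"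
  shows "u * log 2 (u / (r * s)) + v * log 2 (v / (r * t))
    \<le> - (r * binary_entropy d) - u * log 2 s - v * log 2 t"
proof (cases "r = 0")
  case True
  \<comment> \<open>A value of probability zero contributes nothing: the factors \<open>u\<close>
    and \<open>v\<close> vanish, whatever the logarithm of a quotient by zero is.\<close>
  then have "u = 0" "v = 0" using assms by auto
  then show ?thesis using True by simp
next
  case False
  then have r: "0 < r" using assms by simp
  then have u: "0 < u" and v: "0 < v"
    using assms by (smt (verit) mult_pos_pos)+
  \<comment> \<open>This is \<open>P (Y = 0 | X = a)\<close>; the lower bounds on \<open>u\<close>
    and \<open>v\<close> confine it to \<open>[d, 1 - d]\<close>.\<close>
  define q where "q = u / r"
  have uq: "u = r * q" and vq: "v = r * (1 - q)"
    using r assms(2) by (simp_all add: q_def right_diff_distrib)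
  have q: "0 < q" "0 < 1 - q" "d \<le> q" "q \<le> 1 - d"
    using r u v assms(3,4) unfolding uq vq by (simp_all add: zero_less_mult_iff mult.commute)
  have "u / (r * s) = q / s" "v / (r * t) = (1 - q) / t"
    using r by (simp_all add: uq vq)
  then have logs: "log 2 (u / (r * s)) = log 2 q - log 2 s"
      "log 2 (v / (r * t)) = log 2 (1 - q) - log 2 t"
    using q assms by (simp_all add: log_divide)
  have "u * log 2 (u / (r * s)) + v * log 2 (v / (r * t))
      = - (r * binary_entropy q) - u * log 2 s - v * log 2 t"
    unfolding logs by (simp add: uq vq binary_entropy_def algebra_simps)
  moreover have "r * binary_entropy d \<le> r * binary_entropy q"
    using r q assms by (intro mult_left_mono binary_entropy_ge) auto
  ultimately show ?thesis by simp
qed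

text \<open>All that matters about the channel is that each output has conditional probability at
  least \<open>d\<close> given any value of \<open>X\<close>. The hypothesis says so without
  division, so values of probability zero need no exception.\<close>

lemma mutual_information_binary_output_le:
  fixes X :: "'a \<Rightarrow> 'b" and Y :: "'a \<Rightarrow> int"
  assumes "information_space M 2"
    and sf: "simple_function M X" "simple_function M Y"
    and Y: "Y ` space M = {0, 1}"
    and d: "0 < d"
    and cond: "\<And>a y. a \<in> X ` space M \<Longrightarrow> y \<in> {0, 1} \<Longrightarrow>
      d * measure M (X -` {a} \<inter> space M)
        \<le> measure M ((\<lambda>w. (X w, Y w)) -` {(a, y)} \<inter> space M)"
  shows "prob_space.mutual_information M 2 (count_space (X ` space M)) (count_space {0, 1}) X Y
    \<le> 1 - binary_entropy d"
proof -
  interpret information_space M 2 by fact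
  define Px where "Px x = prob (X -` {x} \<inter> space M)" for x
  define Py where "Py y = prob (Y -` {y} \<inter> space M)" for y
  define Pxy where "Pxy z = prob ((\<lambda>w. (X w, Y w)) -` {z} \<inter> space M)" for z
  let ?A = "X ` space M"
  have fin: "finite ?A" using sf(1) by (rule simple_functionD)
  have sX: "simple_distributed M X Px"
    by (rule simple_distributedI) (auto simp: sf Px_def)
  have sY: "simple_distributed M Y Py"
    by (rule simple_distributedI) (auto simp: sf Py_def)
  have XY: "simple_function M (\<lambda>w. (X w, Y w))"
    using sf by (rule simple_function_Pair)
  have sXY: "simple_distributed M (\<lambda>w. (X w, Y w)) Pxy"
    by (rule simple_distributedI) (auto simp: XY Pxy_def)
  have meas: "(\<lambda>w. (X w, Y w)) -` {z} \<inter> space M \<in> sets M" for z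
    using XY by (rule simple_functionD)
  have Px_sum: "Pxy (a, 0) + Pxy (a, 1) = Px a" for a
  proof -
    have "X -` {a} \<inter> space M = ((\<lambda>w. (X w, Y w)) -` {(a, 0)} \<inter> space M)
        \<union> ((\<lambda>w. (X w, Y w)) -` {(a, 1)} \<inter> space M)"
      using Y by auto
    then show ?thesis
      unfolding Px_def Pxy_def using meas by (auto intro!: finite_measure_Union[symmetric])
  qed
  have Py_sum: "(\<Sum>a\<in>?A. Pxy (a, y)) = Py y" for y
  proof -
    have "Y -` {y} \<inter> space M = (\<Union>a\<in>?A. (\<lambda>w. (X w, Y w)) -` {(a, y)} \<inter> space M)"
      by auto
    then have "Py y = prob (\<Union>a\<in>?A. (\<lambda>w. (X w, Y w)) -` {(a, y)} \<inter> space M)"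
      by (simp only: Py_def)
    also have "\<dots> = (\<Sum>a\<in>?A. Pxy (a, y))"
      unfolding Pxy_def using meas fin
      by (intro finite_measure_finite_Union) (auto simp: disjoint_family_on_def)
    finally show ?thesis by simp
  qed
  have Px_total: "(\<Sum>a\<in>?A. Px a) = 1"
    using sX by (rule simple_distributed_sum_space)
  then have Py_total: "Py 0 + Py 1 = 1"
    by (simp add: Py_sum[symmetric] sum.distrib[symmetric] Px_sum)
  then have Py_1: "Py 1 = 1 - Py 0" by simp
  \<comment> \<open>Averaging the conditional bound over \<open>a\<close> keeps both output
    probabilities positive, as the bound on each summand requires.\<close>
  have Py_ge: "d \<le> Py y" if "y \<in> {0, 1}" for y
  proof -
    have "d = (\<Sum>a\<in>?A. d * Px a)"
      using Px_total by (simp add: sum_distrib_left[symmetric])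
    also have "\<dots> \<le> (\<Sum>a\<in>?A. Pxy (a, y))"
      using cond that by (intro sum_mono) (auto simp: Px_def Pxy_def)
    finally show ?thesis by (simp add: Py_sum)
  qed
  have Py_pos: "0 < Py 0" "0 < Py 1" using Py_ge[of 0] Py_ge[of 1] d by auto
  have "mutual_information 2 (count_space ?A) (count_space (Y ` space M)) X Y
      = (\<Sum>(x, y)\<in>(\<lambda>w. (X w, Y w)) ` space M.
          Pxy (x, y) * log 2 (Pxy (x, y) / (Px x * Py y)))"
    by (rule mutual_information_simple_distributed[OF sX sY sXY])
  \<comment> \<open>The sum so far runs over attained pairs only. The pairs added here have empty
    preimage, hence probability zero.\<close>
  also have "\<dots> = (\<Sum>(x, y)\<in>?A \<times> {0, 1}. Pxy (x, y) * log 2 (Pxy (x, y) / (Px x * Py y)))"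
  proof (intro sum.mono_neutral_left)
    have "Pxy z = 0" if "z \<notin> (\<lambda>w. (X w, Y w)) ` space M" for z
    proof -
      have "(\<lambda>w. (X w, Y w)) -` {z} \<inter> space M = {}" using that by auto
      then show ?thesis unfolding Pxy_def by (simp only: measure_empty)
    qed
    then show "\<forall>z\<in>?A \<times> {0, 1} - (\<lambda>w. (X w, Y w)) ` space M.
        (case z of (x, y) \<Rightarrow> Pxy (x, y) * log 2 (Pxy (x, y) / (Px x * Py y))) = 0"
      by auto
  qed (use fin Y in auto)
  also have "\<dots> = (\<Sum>x\<in>?A. Pxy (x, 0) * log 2 (Pxy (x, 0) / (Px x * Py 0))
      + Pxy (x, 1) * log 2 (Pxy (x, 1) / (Px x * Py 1)))"
    by (simp add: sum.cartesian_product[symmetric])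
  also have "\<dots> \<le> (\<Sum>x\<in>?A. - (Px x * binary_entropy d)
      - Pxy (x, 0) * log 2 (Py 0) - Pxy (x, 1) * log 2 (Py 1))"
    using cond d Py_pos Px_sum
    by (intro sum_mono information_summand_le) (auto simp: Px_def Pxy_def)
  \<comment> \<open>Summing over \<open>x\<close> turns joint probabilities into the law of
    \<open>Y\<close>, so the cross terms become exactly its entropy.\<close>
  also have "\<dots> = - binary_entropy d - Py 0 * log 2 (Py 0) - Py 1 * log 2 (Py 1)"
    by (simp add: sum_subtractf sum_negf sum_distrib_right[symmetric] Px_total Py_sum)
  also have "\<dots> = binary_entropy (Py 0) - binary_entropy d"
    by (simp add: binary_entropy_def Py_1)
  also have "\<dots> \<le> 1 - binary_entropy d"
    using Py_pos Py_total binary_entropy_le_1[of "Py 0"] by simp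
  finally show ?thesis unfolding Y .
qed

section \<open>From channels to the joint law, and the capacity bound\<close>

lemma measure_joint_law:
  assumes "finite A" "finite B" "is_channel A B W" "S \<subseteq> A \<times> B"
  shows "measure (joint_law A B W P) S = (\<Sum>(x, y)\<in>S. pmf P x * W x y)"
proof -
  have nn: "0 \<le> (case z of (x, y) \<Rightarrow> pmf P x * W x y)" if "z \<in> S" for z
    using assms(3,4) that by (auto simp: is_channel_def)
  have "emeasure (joint_law A B W P) S = (\<Sum>(x, y)\<in>S. ennreal (pmf P x * W x y))"
    unfolding joint_law_def using assms by (intro emeasure_point_measure_finite) auto
  also have "\<dots> = (\<Sum>z\<in>S. ennreal (case z of (x, y) \<Rightarrow> pmf P x * W x y))"
    by (intro sum.cong) auto
  also have "\<dots> = ennreal (\<Sum>(x, y)\<in>S. pmf P x * W x y)"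
    using nn by (rule sum_ennreal)
  finally show ?thesis
    using nn by (simp add: measure_def sum_nonneg)
qed

lemma input_output_information_le:
  fixes Xs :: "nat \<Rightarrow> 'a set" and W :: "(nat \<Rightarrow> 'a) \<Rightarrow> int \<Rightarrow> real"
  assumes fin: "\<And>i. i \<in> {1..n} \<Longrightarrow> finite (Xs i) \<and> Xs i \<noteq> {}"
    and W: "is_channel (PiE {1..n} Xs) {0, 1} W"
    and d: "0 < d" "\<And>x y. x \<in> PiE {1..n} Xs \<Longrightarrow> y \<in> {0, 1} \<Longrightarrow> d \<le> W x y"
    and i: "i \<in> {1..n}" and P: "P \<in> distributions_on (PiE {1..n} Xs)"
  shows "input_output_information n Xs {0, 1} W i P \<le> 1 - binary_entropy d"
proof -
  let ?A = "PiE {1..n} Xs" and ?B = "{0, 1} :: int set"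
  let ?M = "joint_law ?A ?B W P"
  let ?X = "\<lambda>(x, y). x i" and ?Y = "\<lambda>(x, y). y"
  have finA: "finite ?A" using fin by (intro finite_PiE) auto
  have neA: "?A \<noteq> {}" using fin by (auto simp: PiE_eq_empty_iff)
  interpret prob_space ?M
    using finA W P by (intro prob_space_joint_law) auto
  interpret information_space ?M 2 by unfold_locales simp
  have sp: "space ?M = ?A \<times> ?B" by (simp add: joint_law_def space_point_measure)
  have eqA: "(\<lambda>x. x i) ` ?A = Xs i" using i neA by (simp add: image_projection_PiE)
  have X: "?X ` space ?M = Xs i" unfolding sp eqA[symmetric] by force
  have Y: "?Y ` space ?M = ?B"
    using neA unfolding sp snd_def[symmetric] by (simp only: snd_image_times) simp
  have sf: "simple_function ?M ?X" "simple_function ?M ?Y"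
    unfolding joint_law_def using finA by auto
  have "d * measure ?M (?X -` {a} \<inter> space ?M)
      \<le> measure ?M ((\<lambda>w. (?X w, ?Y w)) -` {(a, y)} \<inter> space ?M)"
    if y: "y \<in> ?B" for a y
  proof -
    let ?S = "{x \<in> ?A. x i = a}"
    have S: "?S \<subseteq> ?A" by auto
    have "?X -` {a} \<inter> space ?M = ?S \<times> ?B" unfolding sp by auto
    moreover have "measure ?M (?S \<times> ?B) = (\<Sum>(x, y)\<in>?S \<times> ?B. pmf P x * W x y)"
      using finA W S by (intro measure_joint_law) auto
    ultimately have "measure ?M (?X -` {a} \<inter> space ?M)
        = (\<Sum>(x, y)\<in>?S \<times> ?B. pmf P x * W x y)"
      by (simp only:)
    also have "\<dots> = (\<Sum>x\<in>?S. pmf P x * (\<Sum>y\<in>?B. W x y))"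
      by (simp only: sum.cartesian_product[symmetric] sum_distrib_left)
    also have "\<dots> = (\<Sum>x\<in>?S. pmf P x)"
      using W by (intro sum.cong) (auto simp: is_channel_def)
    finally have "d * measure ?M (?X -` {a} \<inter> space ?M) = (\<Sum>x\<in>?S. pmf P x * d)"
      by (simp add: sum_distrib_left mult.commute)
    \<comment> \<open>The averaging step: the mass of \<open>X\<^sub>i = a, Y = y\<close> is a sum
      of transition probabilities, each at least \<open>d\<close>, weighted by the input
      law.\<close>
    also have "\<dots> \<le> (\<Sum>x\<in>?S. pmf P x * W x y)"
      using d(2) y by (intro sum_mono mult_left_mono) auto
    also have "\<dots> = (\<Sum>(x, y)\<in>?S \<times> {y}. pmf P x * W x y)"
      by (simp add: sum.cartesian_product[symmetric])
    also have "\<dots> = measure ?M (?S \<times> {y})"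
      using finA W y by (intro measure_joint_law[symmetric]) auto
    also have "?S \<times> {y} = (\<lambda>w. (?X w, ?Y w)) -` {(a, y)} \<inter> space ?M"
      using y unfolding sp by auto
    finally show ?thesis .
  qed
  then show ?thesis
    unfolding input_output_information_def X[symmetric]
    using sf Y d(1)
    by (intro mutual_information_binary_output_le information_space_axioms) auto
qed

text \<open>The exponent \<open>\<bar>y - f x\<bar>\<close> is 0 or 1, so every transition
  probability is \<open>p\<close> or \<open>1 - p\<close>.\<close>

lemma binary_symmetric_channel_ge:
  assumes "f x \<in> {0, 1}" "y \<in> {0, 1}" "d \<le> p" "d \<le> 1 - p"
  shows "d \<le> binary_symmetric_channel p f x y"
  using assms by (auto simp: binary_symmetric_channel_def)

theorem mainTheorem4:
  fixes n :: nat
    and Xs :: "nat \<Rightarrow> 'a set"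
    and f :: "(nat \<Rightarrow> 'a) \<Rightarrow> int"
    and p p_star \<epsilon> :: real
  assumes "n \<ge> 1"
    and "\<And>i. i \<in> {1..n} \<Longrightarrow> finite (Xs i) \<and> Xs i \<noteq> {}"
    and "f \<in> PiE {1..n} Xs \<rightarrow> {0, 1}"
    and "0 < p" and "p < 1"
    and "0 < \<epsilon>" and "\<epsilon> < 1"
    and "0 < p_star" and "p_star < 1/2"
    and "binary_entropy p_star = log 2 2 - \<epsilon>"
    and "p_star < p" and "p < 1 - p_star"
  shows "information_privacy n Xs {0, 1} (distributions_on (PiE {1..n} Xs))
           (binary_symmetric_channel p f) \<epsilon>"
proof -
  let ?A = "PiE {1..n} Xs"
  have "?A \<noteq> {}" using assms(2) by (auto simp: PiE_eq_empty_iff)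
  then obtain x where "x \<in> ?A" by auto
  \<comment> \<open>A point mass makes the index set of the supremum nonempty; a supremum of reals
    is bounded by a common upper bound only then.\<close>
  then have "return_pmf x \<in> distributions_on ?A" by (simp add: distributions_on_def)
  then have ne: "{1..n} \<times> distributions_on ?A \<noteq> {}" using assms(1) by auto
  \<comment> \<open>Here \<open>d\<close> is \<open>p_star\<close>, which lies below both
    \<open>p\<close> and \<open>1 - p\<close>; as \<open>log 2 2 = 1\<close>, the bound equals
    \<epsilon>.\<close>
  have "input_output_information n Xs {0, 1} (binary_symmetric_channel p f) i P
      \<le> 1 - binary_entropy p_star"
    if "i \<in> {1..n}" "P \<in> distributions_on ?A" for i P
    using assms that
    by (intro input_output_information_le is_channel_binary_symmetric_channel
        binary_symmetric_channel_ge) (auto simp: Pi_iff)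
  then show ?thesis
    unfolding information_privacy_def individual_capacity_def
    using ne assms(10) by (intro cSUP_least) auto
qed

end
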